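(* Let $d\ge 3$ be an integer, and let $Z(F)\subset\mathbb{P}^3$, $F=x_0f_{d-1}+f_d$, be a normalized non-degenerate monoid surface of degree $d$ defined by real polynomials $f_{d-1},f_d\in\mathbb{R}[x_1,x_2,x_3]$. Then every real singular point of $Z(F)$ other than $O=(1:0:0:0)$ is of type $A^-$; that is, it is an $A_n^-$ singularity for some $n\ge 1$.
   Context: Normalized non-degenerate monoid surface over $\mathbb{R}$: for $d\ge3$, $f_{d-1}$ and $f_d$ are homogeneous polynomials in $\mathbb{R}[x_1,x_2,x_3]$ of degrees $d-1$ and $d$, and the surface is $Z(F)\subset\mathbb{P}^3$, with $F=x_0f_{d-1}+f_d$, where: (i) $f_{d-1}\neq0$ and $f_d\neq 0$; (ii) $\gcd(f_{d-1},f_d)=1$; (iii) the curves $Z(f_{d-1})\subset\mathbb{P}^2$ and $Z(f_d)\subset\mathbb{P}^2$ (over $\mathbb{C}$) have no common singular point (a point of a plane curve $Z(f)$ is singular if $f$ vanishes there to order at least $2$; in particular every point of a multiple component is singular). A real singular point $P$ of $Z(F)$ is an $A_n^-$ singularity ($n\ge1$) if, in suitable real local coordinates $y_1,y_2,y_3$ of $\mathbb{P}^3$ centered at $P$ (real analytic, or equivalently formal, coordinate change), the local equation of $Z(F)$ at $P$ is, up to multiplication by an invertible real power series, $y_1^2-y_2^2+y_3^{n+1}$. "Type $A^-$" means $A_n^-$ for some $n$. *)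

theory Defs
  imports
    "HOL-Computational_Algebra.Computational_Algebra"
    "HOL-Computational_Algebra.Field_as_Ring"
    "HOL-Analysis.Determinants"
begin

unbundle no fps_syntax

section \<open>Polynomials in three and four variables\<close>

text \<open>
  Ternary polynomials over \<open>'a\<close> are nested univariate ones, with \<open>x\<^sub>1\<close> the outermost and
  \<open>x\<^sub>3\<close> the innermost variable: \<open>coeff (coeff (coeff f i) j) k\<close> is the coefficient of
  \<open>x\<^sub>1\<^sup>i x\<^sub>2\<^sup>j x\<^sub>3\<^sup>k\<close>. In quaternary polynomials \<open>x\<^sub>0\<close> is added as the new outermost variable.
  Thus \<open>gcd\<close> on the nested type is the gcd of the factorial ring \<open>\<real>[x\<^sub>1, x\<^sub>2, x\<^sub>3]\<close>.
\<close>

type_synonym 'a poly3 = "'a poly poly poly"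
type_synonym 'a poly4 = "'a poly poly poly poly"

definition homogeneous3 :: "nat \<Rightarrow> 'a::zero poly3 \<Rightarrow> bool" where
  "homogeneous3 d f \<longleftrightarrow>
     (\<forall>i j k. coeff (coeff (coeff f i) j) k \<noteq> 0 \<longrightarrow> i + j + k = d)"

text \<open>
  In the evaluations, \<open>h\<close> maps the coefficients into the ring of the arguments; it is always
  a ring homomorphism below (identity, \<open>complex_of_real\<close>, or the embedding of
  constants into power series).
\<close>

definition eval3 ::
  "('a::zero \<Rightarrow> 'b::comm_ring_1) \<Rightarrow> 'a poly3 \<Rightarrow> 'b \<Rightarrow> 'b \<Rightarrow> 'b \<Rightarrow> 'b" where
  "eval3 h f x1 x2 x3 =
     poly (map_poly (\<lambda>q. poly (map_poly (\<lambda>r. poly (map_poly h r) x3) q) x2) f) x1"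

definition eval4 ::
  "('a::zero \<Rightarrow> 'b::comm_ring_1) \<Rightarrow> 'a poly4 \<Rightarrow> 'b \<Rightarrow> 'b \<Rightarrow> 'b \<Rightarrow> 'b \<Rightarrow> 'b" where
  "eval4 h F x0 x1 x2 x3 = poly (map_poly (\<lambda>f. eval3 h f x1 x2 x3) F) x0"

section \<open>Singular points\<close>

text \<open>
  Points of projective space are represented by nonzero vectors of homogeneous coordinates.
  A plane curve uses the indices \<open>1, 2, 3\<close> of type \<^typ>\<open>3\<close>, a surface the indices
  \<open>0, 1, 2, 3\<close> of type \<^typ>\<open>4\<close>. Vanishing to order at least two means that the polynomial
  and all its first partial derivatives vanish.
\<close>

definition curve_singular_at :: "real poly3 \<Rightarrow> complex ^ 3 \<Rightarrow> bool" where
  "curve_singular_at f z \<longleftrightarrow> z \<noteq> 0 \<and>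
     (\<forall>g \<in> {f, pderiv f, map_poly pderiv f, map_poly (map_poly pderiv) f}.
        eval3 complex_of_real g (z $ 1) (z $ 2) (z $ 3) = 0)"

definition surface_singular_at :: "real poly4 \<Rightarrow> real ^ 4 \<Rightarrow> bool" where
  "surface_singular_at F P \<longleftrightarrow> P \<noteq> 0 \<and>
     (\<forall>G \<in> {F, pderiv F, map_poly pderiv F, map_poly (map_poly pderiv) F,
             map_poly (map_poly (map_poly pderiv)) F}.
        eval4 id G (P $ 0) (P $ 1) (P $ 2) (P $ 3) = 0)"

definition same_point :: "real ^ 'n \<Rightarrow> real ^ 'n \<Rightarrow> bool" where
  "same_point P Q \<longleftrightarrow> (\<exists>c. c \<noteq> 0 \<and> P = c *s Q)"

section \<open>Monoid surfaces\<close>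

text \<open>The polynomial \<open>x\<^sub>0 f + g\<close>, where \<open>f\<close> and \<open>g\<close> do not involve \<open>x\<^sub>0\<close>.\<close>

definition monoid_poly :: "real poly3 \<Rightarrow> real poly3 \<Rightarrow> real poly4" where
  "monoid_poly f g = monom 1 1 * [:f:] + [:g:]"

definition nondegenerate_monoid :: "nat \<Rightarrow> real poly3 \<Rightarrow> real poly3 \<Rightarrow> bool" where
  "nondegenerate_monoid d f g \<longleftrightarrow>
     homogeneous3 (d - 1) f \<and> homogeneous3 d g \<and>
     f \<noteq> 0 \<and> g \<noteq> 0 \<and>
     gcd f g = 1 \<and>
     \<not> (\<exists>z. curve_singular_at f z \<and> curve_singular_at g z)"

section \<open>Singularities of type \<open>A\<^sub>n\<^sup>-\<close>\<close>

text \<open>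
  \<open>\<real>[[t\<^sub>1, t\<^sub>2, t\<^sub>3]]\<close> as nested univariate power series, with \<open>t\<^sub>1\<close> outermost and \<open>t\<^sub>3\<close> innermost.
\<close>

type_synonym series3 = "real fps fps fps"

definition coeff3 :: "series3 \<Rightarrow> nat \<Rightarrow> nat \<Rightarrow> nat \<Rightarrow> real" where
  "coeff3 s i j k = fps_nth (fps_nth (fps_nth s i) j) k"

definition const3 :: "real \<Rightarrow> series3" where
  "const3 c = fps_const (fps_const (fps_const c))"

definition t1 :: series3 where "t1 = fps_X"
definition t2 :: series3 where "t2 = fps_const fps_X"
definition t3 :: series3 where "t3 = fps_const (fps_const fps_X)"

text \<open>
  A formal change of coordinates at the origin, given by the new coordinates as power series
  in the old ones: no constant terms, and the Jacobian matrix at the origin is regular.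
\<close>

definition local_coordinates :: "series3 \<Rightarrow> series3 \<Rightarrow> series3 \<Rightarrow> bool" where
  "local_coordinates y1 y2 y3 \<longleftrightarrow>
     coeff3 y1 0 0 0 = 0 \<and> coeff3 y2 0 0 0 = 0 \<and> coeff3 y3 0 0 0 = 0 \<and>
     det (vector [vector [coeff3 y1 1 0 0, coeff3 y1 0 1 0, coeff3 y1 0 0 1],
                  vector [coeff3 y2 1 0 0, coeff3 y2 0 1 0, coeff3 y2 0 0 1],
                  vector [coeff3 y3 1 0 0, coeff3 y3 0 1 0, coeff3 y3 0 0 1]]
          :: real ^ 3 ^ 3) \<noteq> 0"

text \<open>
  The equation of \<open>Z(F)\<close> in the standard affine chart \<open>x\<^sub>i = 1\<close>, expanded at \<open>P\<close>, where
  \<open>P $ i \<noteq> 0\<close>: the local parameters \<open>t\<^sub>1, t\<^sub>2, t\<^sub>3\<close> are the differences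
  \<open>x\<^sub>j / x\<^sub>i - P\<^sub>j / P\<^sub>i\<close> for \<open>j \<noteq> i\<close>, in increasing order of \<open>j\<close>.
\<close>

definition local_equation :: "4 \<Rightarrow> real poly4 \<Rightarrow> real ^ 4 \<Rightarrow> series3" where
  "local_equation i F P =
     (let a = (\<lambda>j. const3 (P $ j / P $ i)) in
      if i = 0 then eval4 const3 F 1 (a 1 + t1) (a 2 + t2) (a 3 + t3)
      else if i = 1 then eval4 const3 F (a 0 + t1) 1 (a 2 + t2) (a 3 + t3)
      else if i = 2 then eval4 const3 F (a 0 + t1) (a 1 + t2) 1 (a 3 + t3)
      else eval4 const3 F (a 0 + t1) (a 1 + t2) (a 2 + t3) 1)"

text \<open>
  The choice of the chart does not matter: passing to another one is a coordinate change and
  multiplies the equation of a homogeneous \<open>F\<close> by an invertible power series.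
\<close>

definition A_minus_singularity :: "nat \<Rightarrow> real poly4 \<Rightarrow> real ^ 4 \<Rightarrow> bool" where
  "A_minus_singularity n F P \<longleftrightarrow> n \<ge> 1 \<and> surface_singular_at F P \<and>
     (\<exists>i. P $ i \<noteq> 0 \<and>
       (\<exists>y1 y2 y3 u. local_coordinates y1 y2 y3 \<and> u dvd 1 \<and>
          local_equation i F P = u * (y1 ^ 2 - y2 ^ 2 + y3 ^ (n + 1))))"

end

theory Submission
  imports Defs
begin

text \<open>
  A singular point other than \<open>(1:0:0:0)\<close> lies over a common zero \<open>a\<close> of \<open>f\<close> and \<open>g\<close>, at which \<open>f\<close>
  must be smooth, since otherwise \<open>g\<close> would be singular there, too. In an affine chart the
  equation becomes \<open>t\<^sub>1 F + G\<close> with power series \<open>F, G\<close> in \<open>t\<^sub>2, t\<^sub>3\<close>, where \<open>F\<close> has order one and \<open>G\<close> has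
  order at least two. Dividing by \<open>F\<close> gives \<open>G = F k + h\<close> with \<open>h\<close> a power series in one of
  \<open>t\<^sub>2, t\<^sub>3\<close>, so that the equation is \<open>F (t\<^sub>1 + k) + h\<close>. If \<open>h \<noteq> 0\<close>, then up to sign \<open>h\<close> is a power of
  a local parameter, and the product \<open>F (t\<^sub>1 + k)\<close> is a difference of two squares.

  If \<open>h = 0\<close>, then \<open>f\<close> and \<open>g\<close> vanish on a common formal arc through \<open>a\<close>. Eliminating \<open>x\<^sub>1\<close> shows that
  \<open>x\<^sub>2 : x\<^sub>3\<close> is algebraic over \<open>\<real>\<close> on the arc, hence constant; on the corresponding line \<open>f\<close> or \<open>g\<close>
  does not vanish identically, as they are coprime, so the arc is constant, which is absurd.
\<close>

unbundle no fps_syntax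

section \<open>Evaluation of polynomials\<close>

text \<open>A nonzero element \<open>s\<close> of least degree in the ideal of \<open>f\<close> and
  \<open>g\<close> pseudo-divides every member \<open>u\<close> of it, since the pseudo-remainder
  lies in the ideal, too. Passing to primitive parts removes the factor \<open>a\<close>, so
  \<open>primitive_part s\<close> divides \<open>gcd f g = 1\<close> and \<open>s\<close> has degree
  zero. Here it serves to eliminate the outermost variable.\<close>

lemma coprime_poly_elimination:
  fixes f g :: "'a :: {factorial_ring_gcd, semiring_gcd_mult_normalize} poly"
  assumes "gcd f g = 1"
  shows "\<exists>A B r. r \<noteq> 0 \<and> A * f + B * g = [:r:]"
proof -
  define I where "I = {A * f + B * g |A B. True} - {0}"
  have "f \<noteq> 0 \<or> g \<noteq> 0"
    using assms by auto
  moreover have "f = 1 * f + 0 * g" "g = 0 * f + 1 * g"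
    by simp_all
  ultimately obtain s0 where "s0 \<in> I"
    unfolding I_def by blast
  then obtain s where s: "s \<in> I" and min: "\<And>t. t \<in> I \<Longrightarrow> degree s \<le> degree t"
    using arg_min_nat_lemma[of "\<lambda>t. t \<in> I" s0 degree] by blast
  then obtain A B where AB: "s = A * f + B * g" and "s \<noteq> 0"
    unfolding I_def by blast
  have dvd: "primitive_part s dvd u" if u: "u = A' * f + B' * g" for u A' B'
  proof -
    define r where "r = pseudo_mod u s"
    obtain a q where a: "a \<noteq> 0" and q: "smult a u = s * q + r"
      using pseudo_mod(1)[OF \<open>s \<noteq> 0\<close>, of u] unfolding r_def by blast
    have "r = smult a u - s * q"
      using q by simp
    also have "\<dots> = ([:a:] * A' - A * q) * f + ([:a:] * B' - B * q) * g"
      by (simp add: u AB algebra_simps smult_add_right)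
    finally have "r = 0"
      using min[of r] pseudo_mod(2)[OF \<open>s \<noteq> 0\<close>, of u]
      unfolding r_def[symmetric] I_def by fastforce
    with q have "s dvd smult a u"
      by simp
    then have "primitive_part s dvd primitive_part (smult a u)"
      by blast
    also have "\<dots> dvd primitive_part u"
    proof -
      obtain v where "1 = unit_factor a * v"
        using a unit_factor_is_unit by (metis dvdE)
      then have "primitive_part u = primitive_part (smult a u) * [:v:]"
        by (simp add: primitive_part_smult mult_ac)
      then show ?thesis
        by (rule dvdI)
    qed
    also have "\<dots> dvd u"
      by (metis content_times_primitive_part dvd_refl dvd_smult)
    finally show ?thesis .
  qed
  have "primitive_part s dvd gcd f g"
    using dvd[of f 1 0] dvd[of g 0 1] by simp
  with assms have "degree s = 0"
    by (metis degree_primitive_part is_unit_polyE degree_pCons_0)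
  then obtain r where "s = [:r:]"
    by (meson degree_eq_zeroE)
  with AB \<open>s \<noteq> 0\<close> show ?thesis
    by (intro exI[of _ A] exI[of _ B] exI[of _ r]) auto
qed

section \<open>Ring homomorphisms and nested evaluation\<close>

definition ring_morphism :: "('a :: comm_ring_1 \<Rightarrow> 'b :: comm_ring_1) \<Rightarrow> bool" where
  "ring_morphism h \<longleftrightarrow>
     h 1 = 1 \<and> (\<forall>x y. h (x + y) = h x + h y) \<and> (\<forall>x y. h (x * y) = h x * h y)"

lemma ring_morphismD:
  assumes "ring_morphism h"
  shows "h 0 = 0" "h 1 = 1" "h (x + y) = h x + h y" "h (x * y) = h x * h y"
    "h (x ^ n) = h x ^ n" "h (x - y) = h x - h y" "h (- x) = - h x"
proof -
  show add: "h (x + y) = h x + h y" and mult: "h (x * y) = h x * h y" and one: "h 1 = 1" for x y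
    using assms by (auto simp: ring_morphism_def)
  show zero: "h 0 = 0"
    using add[of 0 0] by simp
  show "h (x ^ n) = h x ^ n"
    by (induction n) (auto simp: mult one)
  show minus: "h (- x) = - h x" for x
    using add[of x "- x"] zero by (simp add: eq_neg_iff_add_eq_0 add.commute)
  show "h (x - y) = h x - h y"
    using add[of x "- y"] minus by simp
qed

lemma ring_morphism_of_real: "ring_morphism complex_of_real"
  by (simp add: ring_morphism_def)

lemma ring_morphism_fps_const: "ring_morphism (fps_const :: 'a :: comm_ring_1 \<Rightarrow> _)"
  by (simp add: ring_morphism_def flip: fps_const_add fps_const_mult)

lemma ring_morphism_const_poly: "ring_morphism (\<lambda>c :: 'a :: comm_ring_1. [:c:])"
  by (simp add: ring_morphism_def one_pCons)

lemma ring_morphism_compose: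
  "ring_morphism h \<Longrightarrow> ring_morphism k \<Longrightarrow> ring_morphism (\<lambda>x. k (h x))"
  by (simp add: ring_morphism_def)

lemma poly_map_poly_altdef:
  fixes h :: "'a :: zero \<Rightarrow> 'b :: comm_ring_1"
  assumes "h 0 = 0"
  shows "poly (map_poly h p) x = (\<Sum>i\<le>degree p. h (coeff p i) * x ^ i)"
proof -
  have "poly (map_poly h p) x = (\<Sum>i\<le>degree (map_poly h p). coeff (map_poly h p) i * x ^ i)"
    by (rule poly_altdef)
  also have "\<dots> = (\<Sum>i\<le>degree p. coeff (map_poly h p) i * x ^ i)"
    by (rule sum.mono_neutral_left) (use map_poly_degree_leq[of h p] in \<open>auto simp: coeff_eq_0\<close>)
  finally show ?thesis
    by (simp add: coeff_map_poly assms)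
qed

lemma poly_map_poly_pCons:
  "h 0 = 0 \<Longrightarrow> poly (map_poly h (pCons a p)) x = h a + x * poly (map_poly h p) x"
  by (cases "a = 0 \<and> p = 0") (auto simp: map_poly_pCons)

lemma ring_morphism_poly:
  assumes "ring_morphism h"
  shows "ring_morphism (\<lambda>p. poly (map_poly h p) x)"
proof -
  note [simp] = ring_morphismD[OF assms]
  have add: "poly (map_poly h (p + q)) x = poly (map_poly h p) x + poly (map_poly h q) x" for p q
    by (induction p q rule: poly_induct2) (simp_all add: poly_map_poly_pCons algebra_simps)
  have smult: "poly (map_poly h (smult c q)) x = h c * poly (map_poly h q) x" for c q
    by (induction q) (simp_all add: poly_map_poly_pCons algebra_simps)
  have "poly (map_poly h (p * q)) x = poly (map_poly h p) x * poly (map_poly h q) x" for p q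
    by (induction p) (simp_all add: add smult poly_map_poly_pCons algebra_simps)
  with add show ?thesis
    by (simp add: ring_morphism_def)
qed

lemma ring_morphism_eval3:
  "ring_morphism h \<Longrightarrow> ring_morphism (\<lambda>f. eval3 h f x y z)"
  unfolding eval3_def by (intro ring_morphism_poly)

lemma morphism_poly:
  assumes "ring_morphism \<phi>" "h 0 = 0"
  shows "\<phi> (poly (map_poly h p) x) = poly (map_poly (\<lambda>a. \<phi> (h a)) p) (\<phi> x)"
  by (induction p) (simp_all add: poly_map_poly_pCons ring_morphismD[OF assms(1)] assms(2))

lemma morphism_eval3:
  assumes "ring_morphism \<phi>" "h 0 = 0"
  shows "\<phi> (eval3 h f x y z) = eval3 (\<lambda>c. \<phi> (h c)) f (\<phi> x) (\<phi> y) (\<phi> z)"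
  unfolding eval3_def using assms by (simp add: morphism_poly)

lemma eval3_homogeneous:
  assumes f: "homogeneous3 m f" and h: "h 0 = 0"
  shows "eval3 h f (l * x) (l * y) (l * z) = l ^ m * eval3 h f x y z"
proof -
  have "h (coeff (coeff (coeff f i) j) k) * (l * z) ^ k * (l * y) ^ j * (l * x) ^ i
      = l ^ m * (h (coeff (coeff (coeff f i) j) k) * z ^ k * y ^ j * x ^ i)" for i j k
  proof (cases "coeff (coeff (coeff f i) j) k = 0")
    case False
    with f have "m = i + j + k"
      by (auto simp: homogeneous3_def)
    then show ?thesis
      by (simp add: power_mult_distrib power_add mult_ac)
  qed (simp add: h)
  then show ?thesis
    unfolding eval3_def by (simp add: poly_map_poly_altdef h sum_distrib_left sum_distrib_right)
qed

section \<open>Derivations at a point and the chain rule\<close>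

definition point_derivation :: "('a :: comm_ring_1 \<Rightarrow> 'b :: comm_ring_1) \<Rightarrow> ('a \<Rightarrow> 'b) \<Rightarrow> bool" where
  "point_derivation \<epsilon> D \<longleftrightarrow>
     (\<forall>x y. D (x + y) = D x + D y) \<and> (\<forall>x y. D (x * y) = \<epsilon> x * D y + D x * \<epsilon> y)"

lemma poly_map_poly_mult_right:
  fixes k :: "'a :: zero \<Rightarrow> 'b :: comm_ring_1"
  shows "k 0 = 0 \<Longrightarrow> poly (map_poly (\<lambda>a. k a * c) p) x = poly (map_poly k p) x * c"
  by (simp add: poly_map_poly_altdef sum_distrib_right sum_distrib_left mult_ac)

lemma poly_map_poly_add:
  fixes h k :: "'a :: zero \<Rightarrow> 'b :: comm_ring_1"
  assumes "h 0 = 0" "k 0 = 0"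
  shows "poly (map_poly (\<lambda>a. h a + k a) p) x = poly (map_poly h p) x + poly (map_poly k p) x"
  by (simp add: poly_map_poly_altdef assms sum.distrib algebra_simps)

lemma poly_map_poly_zero: "poly (map_poly (\<lambda>a. 0) p) x = (0 :: 'b :: comm_ring_1)"
  by (simp add: poly_map_poly_altdef)

text \<open>The chain rule with non-constant coefficients: the first summand differentiates the
  coefficients \<open>h a\<close>. In a nested evaluation these are evaluations in the remaining
  variables, so \<open>D\<close> need not kill them.\<close>

lemma derivation_poly:
  assumes \<epsilon>: "ring_morphism \<epsilon>" and D: "point_derivation \<epsilon> D" and h: "ring_morphism h"
  shows "D (poly (map_poly h p) x) =
    poly (map_poly (\<lambda>a. D (h a)) p) (\<epsilon> x) + poly (map_poly (\<lambda>a. \<epsilon> (h a)) (pderiv p)) (\<epsilon> x) * D x"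
proof -
  have add: "D (x + y) = D x + D y" and mult: "D (x * y) = \<epsilon> x * D y + D x * \<epsilon> y" for x y
    using D by (auto simp: point_derivation_def)
  have zero: "D 0 = 0"
    using add[of 0 0] by simp
  note eps = ring_morphismD[OF \<epsilon>] and hm = ring_morphismD[OF h]
  note ev = ring_morphismD[OF ring_morphism_poly[OF ring_morphism_compose[OF h \<epsilon>]]]
  show ?thesis
    by (induction p)
      (simp_all add: zero eps hm ev poly_map_poly_pCons pderiv_pCons add mult
        morphism_poly[OF \<epsilon>] algebra_simps)
qed

lemma derivation_eval3:
  fixes x y z
  assumes \<epsilon>: "ring_morphism \<epsilon>" and D: "point_derivation \<epsilon> D" and h: "ring_morphism h"
    and Dh: "\<And>c. D (h c) = 0"
  defines "ev \<equiv> \<lambda>f. eval3 (\<lambda>c. \<epsilon> (h c)) f (\<epsilon> x) (\<epsilon> y) (\<epsilon> z)"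
  shows "D (eval3 h f x y z) = ev (pderiv f) * D x + ev (map_poly pderiv f) * D y
     + ev (map_poly (map_poly pderiv) f) * D z"
proof -
  note h0 = ring_morphismD(1)[OF h] and e0 = ring_morphismD(1)[OF \<epsilon>]
  note h3 = ring_morphism_poly[OF h, of z]
  note h2 = ring_morphism_poly[OF h3, of y]
  show ?thesis
    unfolding ev_def eval3_def
    by (simp add: derivation_poly[OF \<epsilon> D] h h3 h2 Dh h0 e0 morphism_poly[OF \<epsilon>]
        map_poly_map_poly o_def poly_map_poly_mult_right poly_map_poly_add poly_map_poly_zero distrib_right)
qed

section \<open>Common zeros of coprime ternary forms\<close>

text \<open>Comparing constant terms shows that \<open>fps_nth w 0\<close> is a root of
  \<open>q\<close>. Splitting off its linear factor leaves either \<open>w\<close> equal to this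
  constant or \<open>w\<close> as a root of a polynomial of smaller degree.\<close>

lemma fps_root_of_constant_poly:
  fixes q :: "'a :: idom poly" and w :: "'a fps"
  assumes "q \<noteq> 0" "poly (map_poly fps_const q) w = 0"
  shows "w = fps_const (fps_nth w 0)"
  using assms
proof (induction "degree q" arbitrary: q rule: less_induct)
  case less
  let ?c = "fps_nth w 0"
  note ev = ring_morphismD[OF ring_morphism_poly[OF ring_morphism_fps_const]]
  have "ring_morphism (\<lambda>s :: 'a fps. fps_nth s 0)"
    by (simp add: ring_morphism_def)
  from morphism_poly[OF this, of fps_const q w] have "poly q ?c = 0"
    using less.prems by simp
  then obtain q' where q': "q = [:- ?c, 1:] * q'"
    by (auto simp: poly_eq_0_iff_dvd)
  with less.prems have "q' \<noteq> 0"
    by auto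
  have "degree q' < degree q"
    using \<open>q' \<noteq> 0\<close> by (simp add: q' degree_mult_eq del: mult_pCons_left)
  have "(w - fps_const ?c) * poly (map_poly fps_const q') w = 0"
    using less.prems(2)
    by (simp add: q' ev poly_map_poly_pCons del: mult_pCons_left flip: fps_const_neg)
  then show ?case
    using less.hyps[OF \<open>degree q' < degree q\<close> \<open>q' \<noteq> 0\<close>] by auto
qed

text \<open>Dividing the form by \<open>z ^ e\<close> gives a nontrivial algebraic equation with
  constant coefficients for the quotient \<open>y / z\<close>, which is therefore constant.\<close>

lemma fps_binary_form_zero_of_dvd:
  fixes y z :: "real fps"
  assumes sum: "(\<Sum>j\<le>e. fps_const (c j) * y ^ j * z ^ (e - j)) = 0"
    and c: "j0 \<le> e" "c j0 \<noteq> 0" and z: "z \<noteq> 0" "z dvd y"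
  shows "\<exists>a. y = fps_const a * z"
proof -
  obtain w where w: "y = z * w"
    using z by blast
  define q where "q = (\<Sum>j\<le>e. monom (c j) j)"
  have "coeff q j0 = c j0"
    using c by (simp add: q_def coeff_sum if_distrib sum.delta cong: if_cong)
  with c have "q \<noteq> 0"
    by auto
  have "poly (map_poly fps_const q) w = (\<Sum>j\<le>e. fps_const (c j) * w ^ j)"
  proof -
    have mono: "poly (map_poly fps_const (monom a n)) w = fps_const a * w ^ n" for a :: real and n
      by (simp add: map_poly_monom poly_monom)
    have "poly (map_poly fps_const (\<Sum>j\<in>A. monom (c j) j)) w = (\<Sum>j\<in>A. fps_const (c j) * w ^ j)"
      if "finite A" for A
      using that by (induction A rule: finite_induct)
        (simp_all add: mono ring_morphismD[OF ring_morphism_poly[OF ring_morphism_fps_const]])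
    then show ?thesis
      by (simp add: q_def)
  qed
  moreover have "(\<Sum>j\<le>e. fps_const (c j) * y ^ j * z ^ (e - j))
      = z ^ e * (\<Sum>j\<le>e. fps_const (c j) * w ^ j)"
    unfolding sum_distrib_left
  proof (intro sum.cong refl)
    fix j assume "j \<in> {..e}"
    then have "z ^ e = z ^ j * z ^ (e - j)"
      by (simp flip: power_add)
    then show "fps_const (c j) * y ^ j * z ^ (e - j) = z ^ e * (fps_const (c j) * w ^ j)"
      by (simp add: w power_mult_distrib mult_ac)
  qed
  ultimately have "poly (map_poly fps_const q) w = 0"
    using sum z by simp
  from fps_root_of_constant_poly[OF \<open>q \<noteq> 0\<close> this] w show ?thesis
    by (metis mult.commute)
qed

text \<open>Divisibility of power series over a field is governed by the subdegree, so one of two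
  nonzero series divides the other. If \<open>y\<close> divides \<open>z\<close>, reversing the
  order of the coefficients exchanges the roles.\<close>

lemma fps_binary_form_zero:
  fixes y z :: "real fps"
  assumes sum: "(\<Sum>j\<le>e. fps_const (c j) * y ^ j * z ^ (e - j)) = 0"
    and c: "j0 \<le> e" "c j0 \<noteq> 0"
  shows "\<exists>s a b. (a \<noteq> 0 \<or> b \<noteq> 0) \<and> y = fps_const a * s \<and> z = fps_const b * s"
proof (cases "y = 0 \<or> z = 0")
  case True
  then consider "y = 0" | "z = 0" by blast
  then show ?thesis
  proof cases
    case 1
    then show ?thesis
      by (intro exI[of _ z] exI[of _ 0] exI[of _ 1]) simp
  next
    case 2
    then show ?thesis
      by (intro exI[of _ y] exI[of _ 1] exI[of _ 0]) simp
  qed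
next
  case False
  then consider "z dvd y" | "y dvd z"
    by (metis fps_dvd_iff linear)
  then show ?thesis
  proof cases
    case 1
    then obtain a where "y = fps_const a * z"
      using fps_binary_form_zero_of_dvd[OF sum c] False by blast
    then show ?thesis
      by (intro exI[of _ z] exI[of _ a] exI[of _ 1]) simp
  next
    case 2
    have "(\<Sum>j\<le>e. fps_const (c (e - j)) * z ^ j * y ^ (e - j))
        = (\<Sum>j\<le>e. fps_const (c j) * y ^ j * z ^ (e - j))"
      by (rule sum.reindex_bij_witness[of _ "\<lambda>j. e - j" "\<lambda>j. e - j"]) (auto simp: mult_ac)
    with sum have "(\<Sum>j\<le>e. fps_const (c (e - j)) * z ^ j * y ^ (e - j)) = 0"
      by simp
    from fps_binary_form_zero_of_dvd[OF this, of "e - j0"] 2 False c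
    obtain a where "z = fps_const a * y"
      by auto
    then show ?thesis
      by (intro exI[of _ y] exI[of _ 1] exI[of _ a]) simp
  qed
qed

definition eval2 ::
  "('a::zero \<Rightarrow> 'b::comm_ring_1) \<Rightarrow> 'a poly poly \<Rightarrow> 'b \<Rightarrow> 'b \<Rightarrow> 'b" where
  "eval2 h q y z = poly (map_poly (\<lambda>r. poly (map_poly h r) z) q) y"

lemma eval3_eval2: "eval3 h f x y z = poly (map_poly (\<lambda>q. eval2 h q y z) f) x"
  by (simp add: eval3_def eval2_def)

lemma ring_morphism_eval2: "ring_morphism h \<Longrightarrow> ring_morphism (\<lambda>q. eval2 h q y z)"
  unfolding eval2_def by (intro ring_morphism_poly)

abbreviation fps_poly_const :: "real \<Rightarrow> real fps poly" where
  "fps_poly_const c \<equiv> [:fps_const c:]"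

lemma ring_morphism_fps_poly_const: "ring_morphism fps_poly_const"
  by (rule ring_morphism_compose[OF ring_morphism_fps_const ring_morphism_const_poly])

text \<open>
  The polynomial variable scales the point by a transcendental factor. Hence all homogeneous
  components of \<open>r\<close> vanish at \<open>(y, z)\<close>.
\<close>

lemma eval2_generic_multiple_zero:
  fixes r :: "real poly poly" and y z :: "real fps"
  assumes "r \<noteq> 0" and zero: "eval2 fps_poly_const r (monom y 1) (monom z 1) = 0"
  shows "\<exists>s a b. (a \<noteq> 0 \<or> b \<noteq> 0) \<and> y = fps_const a * s \<and> z = fps_const b * s"
proof -
  \<comment> \<open>The component of degree \<open>e\<close> contains the nested leading coefficient
    of \<open>r\<close>, hence is a nonzero binary form. \<open>e\<close> need not be the total
    degree of \<open>r\<close>.\<close>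
  define j0 where "j0 = degree r"
  define k0 where "k0 = degree (coeff r j0)"
  define e where "e = j0 + k0"
  define c where "c = (\<lambda>j. coeff (coeff r j) (e - j))"
  have "c j0 \<noteq> 0"
    using \<open>r \<noteq> 0\<close> by (simp add: c_def e_def k0_def j0_def)
  have monomial: "[:fps_const a:] * monom z (Suc 0) ^ k * monom y (Suc 0) ^ j
      = monom (fps_const a * y ^ j * z ^ k) (j + k)" for a :: real and j k
    by (simp add: monom_power mult_monom smult_monom mult_ac add_ac)
  have "0 = coeff (eval2 fps_poly_const r (monom y 1) (monom z 1)) e"
    using zero by simp
  also have "\<dots> = (\<Sum>j\<le>degree r. \<Sum>k\<le>degree (coeff r j).
      if j + k = e then fps_const (coeff (coeff r j) k) * y ^ j * z ^ k else 0)"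
    unfolding eval2_def
    by (simp add: poly_map_poly_altdef sum_distrib_right monomial coeff_sum del: mult_pCons_left)
  also have "\<dots> = (\<Sum>j\<le>degree r. if j \<le> e then fps_const (c j) * y ^ j * z ^ (e - j) else 0)"
  proof (intro sum.cong refl)
    fix j
    show "(\<Sum>k\<le>degree (coeff r j).
        if j + k = e then fps_const (coeff (coeff r j) k) * y ^ j * z ^ k else 0) =
       (if j \<le> e then fps_const (c j) * y ^ j * z ^ (e - j) else 0)"
    proof (cases "j \<le> e")
      case True
      then have "j + k = e \<longleftrightarrow> k = e - j" for k
        by auto
      with True show ?thesis
        by (simp add: c_def sum.delta coeff_eq_0)
    qed (auto intro!: sum.neutral)
  qed
  also have "\<dots> = (\<Sum>j\<le>e. if j \<le> e then fps_const (c j) * y ^ j * z ^ (e - j) else 0)"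
    by (rule sum.mono_neutral_left[symmetric] sum.mono_neutral_cong)
      (auto simp: c_def coeff_eq_0 e_def j0_def)
  finally have "(\<Sum>j\<le>e. fps_const (c j) * y ^ j * z ^ (e - j)) = 0"
    by simp
  from fps_binary_form_zero[OF this _ \<open>c j0 \<noteq> 0\<close>] show ?thesis
    by (simp add: e_def)
qed

text \<open>Restriction to the line where \<open>x\<^sub>2\<close> is \<open>c\<close> times
  \<open>x\<^sub>3\<close>: the polynomial \<open>[:0, c:]\<close> is this multiple of the innermost
  variable.\<close>

lemma eval2_substitute_multiple:
  assumes "ring_morphism h"
  shows "eval2 h (map_poly (\<lambda>q. poly q [:0, c:]) f) x s = eval3 h f x (h c * s) s"
proof -
  have "(\<lambda>r. poly (map_poly h r) s) (poly (map_poly id q) [:0, c:])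
      = poly (map_poly (\<lambda>a. poly (map_poly h (id a)) s) q) (poly (map_poly h [:0, c:]) s)" for q
    by (rule morphism_poly) (simp_all add: ring_morphism_poly assms)
  moreover have "poly (map_poly h [:0, c:]) s = h c * s"
    by (simp add: poly_map_poly_pCons ring_morphismD[OF assms] mult.commute)
  ultimately show ?thesis
    by (simp add: eval2_def eval3_def map_poly_map_poly o_def)
qed

lemma eval2_substitute_zero:
  assumes "ring_morphism h"
  shows "eval2 h (map_poly (map_poly (\<lambda>p. poly p 0)) f) x s = eval3 h f x s 0"
proof -
  have "poly (map_poly h r) 0 = h (poly r 0)" for r
    by (induction r) (simp_all add: poly_map_poly_pCons ring_morphismD[OF assms])
  then show ?thesis
    by (simp add: eval2_def eval3_def map_poly_map_poly o_def ring_morphismD(1)[OF assms])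
qed

text \<open>Elimination of the outermost variable yields a nonzero \<open>r\<close> vanishing on the
  arc, so \<open>y\<close> and \<open>z\<close> are constant multiples of one series
  \<open>s\<close>. On the line through the origin of the plane that this ratio defines,
  \<open>f\<close> and \<open>g\<close> do not both restrict to zero, since its linear form would
  divide their gcd. A nonzero restriction then relates \<open>x\<close> to \<open>s\<close> in the
  same way.\<close>

lemma coprime_ternary_common_zero_constant:
  fixes f g :: "real poly3" and x y z :: "real fps"
  assumes gcd: "gcd f g = 1"
    and f: "eval3 fps_poly_const f (monom x 1) (monom y 1) (monom z 1) = 0"
    and g: "eval3 fps_poly_const g (monom x 1) (monom y 1) (monom z 1) = 0"
  shows "\<exists>s a b c. x = fps_const a * s \<and> y = fps_const b * s \<and> z = fps_const c * s"
proof -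
  note h = ring_morphism_fps_poly_const
  note ev = ring_morphismD[OF ring_morphism_eval3[OF h]]
  obtain A B r where "r \<noteq> 0" and r: "A * f + B * g = [:r:]"
    using coprime_poly_elimination[OF gcd] by blast
  have "eval3 fps_poly_const [:r:] (monom x 1) (monom y 1) (monom z 1) = 0"
    unfolding r[symmetric] by (simp only: ev f g) simp
  then have "eval2 fps_poly_const r (monom y 1) (monom z 1) = 0"
    by (simp add: eval3_eval2 poly_map_poly_pCons ring_morphismD[OF ring_morphism_eval2[OF h]])
  from eval2_generic_multiple_zero[OF \<open>r \<noteq> 0\<close> this]
  obtain s b c where bc: "b \<noteq> 0 \<or> c \<noteq> 0" and yz: "y = fps_const b * s" "z = fps_const c * s"
    by blast
  \<comment> \<open>It remains to write \<open>x\<close> and \<open>s\<close> as constant multiples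
    of a common series.\<close>
  have reduce: "x = fps_const a' * s' \<and> s = fps_const b' * s' \<Longrightarrow> ?thesis" for a' b' s'
    by (intro exI[of _ s'] exI[of _ a'] exI[of _ "b * b'"] exI[of _ "c * b'"])
      (simp add: yz mult.assoc flip: fps_const_mult)
  show ?thesis
  proof (cases "c = 0")
    case False
    \<comment> \<open>The linear form of the line: the second variable minus \<open>b / c\<close>
      times the third.\<close>
    define l where "l = [:[:[:0, - (b / c):], 1:]:]"
    let ?sub = "\<lambda>q :: real poly3. map_poly (\<lambda>q. poly q [:0, b / c:]) q"
    have dvd: "l dvd q" if "?sub q = 0" for q
    proof -
      have "poly (coeff q i) [:0, b / c:] = 0" for i
        using arg_cong[OF that, of "\<lambda>q. coeff q i"] by (simp add: coeff_map_poly)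
      then have "[:[:0, - (b / c):], 1:] dvd coeff q i" for i
        by (simp add: poly_eq_0_iff_dvd)
      then show ?thesis
        unfolding l_def by (simp add: const_poly_dvd_iff)
    qed
    have "y = fps_const (b / c) * z"
      using False by (simp add: yz flip: mult.assoc)
    then have "monom y 1 = fps_poly_const (b / c) * monom z 1"
      by (simp add: smult_monom)
    then have sub: "eval2 fps_poly_const (?sub q) (monom x 1) (monom z 1) =
        eval3 fps_poly_const q (monom x 1) (monom y 1) (monom z 1)" for q
      by (simp only: eval2_substitute_multiple[OF h])
    have "?sub f \<noteq> 0 \<or> ?sub g \<noteq> 0"
    proof (rule ccontr)
      assume "\<not> ?thesis"
      then have "l dvd gcd f g"
        using dvd by simp
      then show False
        unfolding gcd l_def by (simp add: is_unit_const_poly_iff is_unit_poly_iff)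
    qed
    then have "\<exists>s' a' b'. (a' \<noteq> 0 \<or> b' \<noteq> 0) \<and> x = fps_const a' * s' \<and> z = fps_const b' * s'"
      using eval2_generic_multiple_zero[of "?sub f" x z] eval2_generic_multiple_zero[of "?sub g" x z]
      by (auto simp only: sub f g)
    then obtain s' a' b' where "x = fps_const a' * s'" "z = fps_const b' * s'"
      by blast
    moreover have "s = fps_const (1 / c) * z"
      using False by (simp add: yz flip: mult.assoc)
    ultimately show ?thesis
      by (intro reduce[of a' s' "1 / c * b'"]) (simp add: mult.assoc flip: fps_const_mult)
  next
    case True
    with bc yz have "z = 0" "b \<noteq> 0"
      by auto
    \<comment> \<open>Now the line is the zero set of the third variable itself.\<close>
    define l :: "real poly3" where "l = [:[:[:0, 1:]:]:]"
    let ?sub = "\<lambda>q :: real poly3. map_poly (map_poly (\<lambda>p. poly p 0)) q"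
    have dvd: "l dvd q" if "?sub q = 0" for q
    proof -
      have "poly (coeff (coeff q i) j) 0 = 0" for i j
        using arg_cong[OF that, of "\<lambda>q. coeff (coeff q i) j"] by (simp add: coeff_map_poly)
      then have "[:0, 1:] dvd coeff (coeff q i) j" for i j
        using poly_eq_0_iff_dvd[of "coeff (coeff q i) j" 0] by simp
      then show ?thesis
        unfolding l_def by (simp add: const_poly_dvd_iff)
    qed
    have sub: "eval2 fps_poly_const (?sub q) (monom x 1) (monom y 1) =
        eval3 fps_poly_const q (monom x 1) (monom y 1) (monom z 1)" for q
      by (simp add: eval2_substitute_zero[OF h] \<open>z = 0\<close>)
    have "?sub f \<noteq> 0 \<or> ?sub g \<noteq> 0"
    proof (rule ccontr)
      assume "\<not> ?thesis"
      then have "l dvd gcd f g"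
        using dvd by simp
      then show False
        unfolding gcd l_def by (simp add: is_unit_const_poly_iff is_unit_poly_iff)
    qed
    then have "\<exists>s' a' b'. (a' \<noteq> 0 \<or> b' \<noteq> 0) \<and> x = fps_const a' * s' \<and> y = fps_const b' * s'"
      using eval2_generic_multiple_zero[of "?sub f" x y] eval2_generic_multiple_zero[of "?sub g" x y]
      by (auto simp only: sub f g)
    then obtain s' a' b' where "x = fps_const a' * s'" "y = fps_const b' * s'"
      by blast
    moreover have "s = fps_const (1 / b) * y"
      using \<open>b \<noteq> 0\<close> by (simp add: yz flip: mult.assoc)
    ultimately show ?thesis
      by (intro reduce[of a' s' "1 / b * b'"]) (simp add: mult.assoc flip: fps_const_mult)
  qed
qed

section \<open>Division by a power series of order one\<close>

text \<open>The embedding of the series in the outer variable; \<open>fps_const\<close> is the one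
  for the inner variable.\<close>

definition fps_outer :: "'a :: comm_ring_1 fps \<Rightarrow> 'a fps fps" where
  "fps_outer h = Abs_fps (\<lambda>n. fps_const (fps_nth h n))"

text \<open>Weierstrass division in the case of order one. Setting the outer variable to zero turns
  \<open>f\<close> into a unit \<open>u\<close> times the inner variable, so every series in the
  inner variable is a multiple of this plus a constant. Hence the outer coefficients
  \<open>k n\<close> of the quotient can be chosen one after the other.\<close>

lemma fps_outer_remainder_exists:
  fixes f x :: "'a :: field fps fps"
  assumes f: "fps_nth (fps_nth f 0) 0 = 0" "fps_nth (fps_nth f 0) 1 \<noteq> 0"
  shows "\<exists>h. f dvd x - fps_outer h"
proof -
  define P where "P = (\<lambda>k n r. \<exists>c. fps_nth x n =
    (\<Sum>i<n. k i * fps_nth f (n - i)) + r * fps_nth f 0 + fps_const c)"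
  define u where "u = fps_shift 1 (fps_nth f 0)"
  have u: "fps_nth f 0 = u * fps_X" "fps_nth u 0 \<noteq> 0"
    using f by (auto simp: u_def fps_eq_iff)
  have "\<exists>k. \<forall>n. P k n (k n)"
  proof (rule dependent_wf_choice[OF wf_less_than])
    show "P k n r = P k' n r" if "\<And>m. (m, n) \<in> less_than \<Longrightarrow> k m = k' m" for k k' n r
      using that by (simp add: P_def)
    show "\<exists>r. P k n r" for n k
    proof -
      let ?R = "fps_nth x n - (\<Sum>i<n. k i * fps_nth f (n - i))"
      have "?R = fps_shift 1 ?R * fps_X + fps_const (fps_nth ?R 0)"
        by (simp add: fps_eq_iff)
      also have "\<dots> = fps_shift 1 ?R * inverse u * fps_nth f 0 + fps_const (fps_nth ?R 0)"
        using inverse_mult_eq_1[OF u(2)] by (simp add: u(1) mult.assoc flip: mult.assoc[of _ u])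
      finally show ?thesis
        unfolding P_def
        by (intro exI[of _ "fps_shift 1 ?R * inverse u"] exI[of _ "fps_nth ?R 0"])
          (simp add: algebra_simps)
    qed
  qed
  then obtain k where "\<forall>n. \<exists>c. fps_nth x n =
      (\<Sum>i<n. k i * fps_nth f (n - i)) + k n * fps_nth f 0 + fps_const c"
    unfolding P_def by blast
  then obtain c where c: "\<And>n. fps_nth x n =
      (\<Sum>i<n. k i * fps_nth f (n - i)) + k n * fps_nth f 0 + fps_const (c n)"
    by metis
  have "x - fps_outer (Abs_fps c) = Abs_fps k * f"
    by (subst fps_eq_iff)
      (simp add: c fps_outer_def fps_mult_nth atLeast0AtMost flip: lessThan_Suc_atMost)
  then show ?thesis
    by (metis dvd_triv_right)
qed

text \<open>Interchanging the variables transfers the division to series whose linear term involves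
  the other variable.\<close>

definition fps_swap :: "'a :: comm_ring_1 fps fps \<Rightarrow> 'a fps fps" where
  "fps_swap s = Abs_fps (\<lambda>i. Abs_fps (\<lambda>j. fps_nth (fps_nth s j) i))"

lemma fps_const_sum: "fps_const (sum c A) = (\<Sum>i\<in>A. fps_const (c i))"
  by (induction A rule: infinite_finite_induct) (simp_all flip: fps_const_add)

lemma ring_morphism_fps_outer: "ring_morphism fps_outer"
  by (auto simp: ring_morphism_def fps_outer_def fps_eq_iff[of "Abs_fps _"] fps_mult_nth[of "Abs_fps _"]
      fps_mult_nth fps_const_sum simp flip: fps_const_add fps_const_mult)

lemma ring_morphism_fps_swap: "ring_morphism fps_swap"
  unfolding ring_morphism_def
proof (intro conjI allI)
  fix x y :: "'a fps fps"
  show "fps_swap (x * y) = fps_swap x * fps_swap y"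
    by (simp add: fps_eq_iff fps_swap_def fps_mult_nth fps_sum_nth)
      (intro allI sum.swap)
qed (auto simp: fps_eq_iff fps_swap_def)

lemma fps_swap_swap: "fps_swap (fps_swap s) = s"
  by (simp add: fps_eq_iff fps_swap_def)

lemma fps_swap_outer: "fps_swap (fps_outer h) = fps_const h"
  by (auto simp: fps_eq_iff fps_swap_def fps_outer_def)

lemma fps_swap_dvd: "f dvd g \<Longrightarrow> fps_swap f dvd fps_swap g"
  by (auto simp: ring_morphismD[OF ring_morphism_fps_swap])

text \<open>This makes remainders unique. Once the lower coefficients of the quotient vanish,
  comparison at index \<open>n\<close> gives a constant equal to
  \<open>fps_nth f 0 * fps_nth q n\<close>. The right-hand side has no constant term, so both sides
  vanish.\<close>

lemma fps_outer_multiple_zero: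
  fixes f :: "'a :: field fps fps"
  assumes f: "fps_nth (fps_nth f 0) 0 = 0" "fps_nth (fps_nth f 0) 1 \<noteq> 0"
    and dvd: "f dvd fps_outer h"
  shows "h = 0"
proof -
  obtain q where q: "fps_outer h = f * q"
    using dvd by blast
  have "fps_nth q n = 0" for n
  proof (induction n rule: less_induct)
    case (less n)
    have "fps_const (fps_nth h n) = (\<Sum>i=0..n. fps_nth f i * fps_nth q (n - i))"
      using arg_cong[OF q, of "\<lambda>s. fps_nth s n"] by (simp add: fps_outer_def fps_mult_nth)
    also have "\<dots> = (\<Sum>i=0..n. if i = 0 then fps_nth f 0 * fps_nth q n else 0)"
      by (rule sum.cong) (auto simp: less)
    finally have eq: "fps_const (fps_nth h n) = fps_nth f 0 * fps_nth q n"
      by simp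
    from arg_cong[OF this, of "\<lambda>s. fps_nth s 0"] f(1) have "fps_nth h n = 0"
      by simp
    moreover have "fps_nth f 0 \<noteq> 0"
      using f(2) by auto
    ultimately show ?case
      using eq by simp
  qed
  then have "q = 0"
    by (intro fps_ext) simp
  with q have "fps_outer h = 0"
    by simp
  then show ?thesis
    by (simp add: fps_outer_def fps_eq_iff[of "Abs_fps _"] fps_eq_iff[of h])
qed

text \<open>Existence and uniqueness of remainders identify the quotient ring modulo
  \<open>f\<close> with the domain of \<epsilon>, and \<rho> is the quotient map. Uniqueness makes
  it compatible with sums and products.\<close>

lemma remainder_morphism:
  assumes \<epsilon>: "ring_morphism \<epsilon>"
    and ex: "\<And>x. \<exists>h. f dvd x - \<epsilon> h"
    and uniq: "\<And>h. f dvd \<epsilon> h \<Longrightarrow> h = 0"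
  shows "\<exists>\<rho>. ring_morphism \<rho> \<and> \<rho> f = 0 \<and> (\<forall>h. \<rho> (\<epsilon> h) = h) \<and> (\<forall>x. f dvd x - \<epsilon> (\<rho> x))"
proof -
  note e = ring_morphismD[OF \<epsilon>]
  from ex obtain \<rho> where \<rho>: "\<And>x. f dvd x - \<epsilon> (\<rho> x)"
    by metis
  have eqI: "\<rho> x = h" if "f dvd x - \<epsilon> h" for x h
  proof -
    have "f dvd (x - \<epsilon> h) - (x - \<epsilon> (\<rho> x))"
      using that \<rho> by (rule dvd_diff)
    then have "f dvd \<epsilon> (\<rho> x - h)"
      by (simp add: e)
    then show ?thesis
      using uniq by fastforce
  qed
  have "\<rho> (x + y) = \<rho> x + \<rho> y" for x y
  proof (rule eqI)
    show "f dvd x + y - \<epsilon> (\<rho> x + \<rho> y)"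
      using dvd_add[OF \<rho>[of x] \<rho>[of y]] by (simp add: e algebra_simps)
  qed
  moreover have "\<rho> (x * y) = \<rho> x * \<rho> y" for x y
  proof (rule eqI)
    have "x * y - \<epsilon> (\<rho> x * \<rho> y) = (x - \<epsilon> (\<rho> x)) * y + (y - \<epsilon> (\<rho> y)) * \<epsilon> (\<rho> x)"
      by (simp add: e algebra_simps)
    then show "f dvd x * y - \<epsilon> (\<rho> x * \<rho> y)"
      using dvd_add[OF dvd_mult2[OF \<rho>[of x]] dvd_mult2[OF \<rho>[of y]]] by simp
  qed
  moreover have "\<rho> 1 = 1" "\<rho> f = 0" "\<rho> (\<epsilon> h) = h" for h
    by (auto intro!: eqI simp: e)
  ultimately show ?thesis
    using \<rho> by (auto simp: ring_morphism_def)
qed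

text \<open>The value and the two first partial derivatives at the origin, the outer variable coming
  first.\<close>

definition coeff00 :: "'a :: zero fps fps \<Rightarrow> 'a" where "coeff00 s = fps_nth (fps_nth s 0) 0"
definition coeff10 :: "'a :: zero fps fps \<Rightarrow> 'a" where "coeff10 s = fps_nth (fps_nth s 1) 0"
definition coeff01 :: "'a :: zero fps fps \<Rightarrow> 'a" where "coeff01 s = fps_nth (fps_nth s 0) 1"

lemmas coeff_defs = coeff00_def coeff10_def coeff01_def

lemma ring_morphism_coeff00: "ring_morphism coeff00"
  by (simp add: ring_morphism_def coeff00_def)

lemma point_derivation_coeff10: "point_derivation coeff00 coeff10"
  by (simp add: point_derivation_def coeff_defs fps_mult_nth)

lemma point_derivation_coeff01: "point_derivation coeff00 coeff01"
  by (simp add: point_derivation_def coeff_defs fps_mult_nth)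

text \<open>
  Here \<open>\<epsilon>\<close> includes the power series in one of the two variables, chosen such that
  \<open>f = 0\<close> is a graph over it; \<open>\<rho>\<close> is the restriction to this graph.
\<close>

lemma smooth_curve_restriction:
  fixes f :: "'a :: field fps fps"
  assumes f: "coeff00 f = 0" and smooth: "coeff10 f \<noteq> 0 \<or> coeff01 f \<noteq> 0"
  obtains \<epsilon> \<rho> where
    "\<epsilon> = fps_outer \<and> coeff01 f \<noteq> 0 \<or> \<epsilon> = fps_const \<and> coeff10 f \<noteq> 0"
    "ring_morphism \<rho>" "\<rho> f = 0" "\<And>h. \<rho> (\<epsilon> h) = h" "\<And>x. f dvd x - \<epsilon> (\<rho> x)"
proof (cases "coeff01 f = 0")
  case False
  then have f': "fps_nth (fps_nth f 0) 0 = 0" "fps_nth (fps_nth f 0) 1 \<noteq> 0"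
    using f by (auto simp: coeff_defs)
  from remainder_morphism[OF ring_morphism_fps_outer, of f]
    fps_outer_remainder_exists[OF f'] fps_outer_multiple_zero[OF f']
  show ?thesis
    using that False by metis
next
  case True
  let ?f = "fps_swap f"
  have f': "fps_nth (fps_nth ?f 0) 0 = 0" "fps_nth (fps_nth ?f 0) 1 \<noteq> 0"
    using f smooth True by (auto simp: coeff_defs fps_swap_def)
  have "\<exists>h. f dvd x - fps_const h" for x
  proof -
    obtain h where "?f dvd fps_swap x - fps_outer h"
      using fps_outer_remainder_exists[OF f'] by metis
    then have "fps_swap ?f dvd fps_swap (fps_swap x - fps_outer h)"
      by (rule fps_swap_dvd)
    then show ?thesis
      by (auto simp: ring_morphismD[OF ring_morphism_fps_swap] fps_swap_swap fps_swap_outer)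
  qed
  moreover have "h = 0" if "f dvd fps_const h" for h
    using fps_swap_dvd[OF that] fps_outer_multiple_zero[OF f', of h]
    by (metis fps_swap_outer fps_swap_swap)
  ultimately show ?thesis
    using remainder_morphism[OF ring_morphism_fps_const, of f] that True smooth by metis
qed

section \<open>Normal form of the local equation\<close>

lemma fps_power_factorization:
  fixes h :: "real fps"
  assumes "h \<noteq> 0" "fps_nth h 0 = 0" "fps_nth h 1 = 0"
  shows "\<exists>n r \<sigma>. n \<ge> 1 \<and> (\<sigma> = 1 \<or> \<sigma> = - 1) \<and> fps_nth r 0 \<noteq> 0 \<and>
    fps_const \<sigma> * h = (fps_X * r) ^ (n + 1)"
proof -
  define m where "m = subdegree h"
  have "fps_nth h m \<noteq> 0"
    using assms by (simp add: m_def)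
  with assms have "m \<noteq> 0" "m \<noteq> 1"
    by metis+
  then obtain n where n: "m = Suc n" "n \<ge> 1"
    by (cases m) auto
  define c where "c = fps_nth h m"
  have "c \<noteq> 0"
    using assms by (simp add: c_def m_def)
  \<comment> \<open>The sign makes the leading coefficient positive, so that the unit part has a
    real root of any order.\<close>
  define \<sigma> where "\<sigma> = sgn c"
  define v where "v = fps_const \<sigma> * fps_shift m h"
  have v0: "fps_nth v 0 > 0"
    using \<open>c \<noteq> 0\<close> by (simp add: v_def \<sigma>_def sgn_mult_self_eq flip: c_def) (simp add: sgn_if)
  define r where "r = fps_radical root (Suc n) v"
  have "r ^ Suc n = v"
    unfolding r_def using power_radical[of v root n] real_root_pow_pos[of "Suc n" "fps_nth v 0"] v0
    by (simp del: power_Suc)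
  have "fps_const \<sigma> * h = fps_const \<sigma> * (fps_shift m h * fps_X ^ m)"
    using subdegree_decompose[of h] by (simp add: m_def)
  also have "\<dots> = (fps_X * r) ^ (n + 1)"
    using \<open>r ^ Suc n = v\<close> by (simp add: power_mult_distrib n(1) v_def mult_ac)
  finally have "fps_const \<sigma> * h = (fps_X * r) ^ (n + 1)" .
  moreover have "fps_nth r 0 \<noteq> 0"
    using v0 by (simp add: r_def)
  moreover have "\<sigma> = 1 \<or> \<sigma> = - 1"
    using \<open>c \<noteq> 0\<close> by (simp add: \<sigma>_def sgn_if)
  ultimately show ?thesis
    using n(2) by blast
qed

text \<open>The equation is \<open>T * f + \<epsilon> h\<close> with \<open>T\<close> the first
  variable plus \<open>k\<close>. Up to the sign \<open>s\<close>, half the sum and half the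
  difference of \<open>T\<close> and \<open>s * f\<close> turn the product into a difference of
  squares, and the remainder is a power of \<open>y3\<close>. The coordinates are independent
  because \<open>T\<close> involves the first variable linearly, whereas the linear term of
  \<open>f\<close> is transverse to the variable of \<epsilon>.\<close>

lemma A_minus_normal_form:
  fixes f k G :: "real fps fps"
  assumes f: "coeff00 f = 0" and G: "G = f * k + \<epsilon> h" "coeff00 G = 0" "coeff10 G = 0" "coeff01 G = 0"
    and "h \<noteq> 0" and \<epsilon>: "\<epsilon> = fps_outer \<and> coeff01 f \<noteq> 0 \<or> \<epsilon> = fps_const \<and> coeff10 f \<noteq> 0"
  shows "\<exists>n\<ge>1. \<exists>y1 y2 y3 u. local_coordinates y1 y2 y3 \<and> u dvd 1 \<and>
    fps_const G + fps_X * fps_const f = u * (y1 ^ 2 - y2 ^ 2 + y3 ^ (n + 1))"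
proof -
  \<comment> \<open>\<open>(p, q)\<close> is the gradient of the local parameter embedded by
    \<epsilon>.\<close>
  define p q :: real where "p = of_bool (\<epsilon> = fps_outer)" and "q = of_bool (\<epsilon> \<noteq> fps_outer)"
  have distinct: "fps_outer \<noteq> (fps_const :: real fps \<Rightarrow> _)"
  proof
    assume "fps_outer = (fps_const :: real fps \<Rightarrow> _)"
    then have "fps_nth (fps_outer (fps_X :: real fps)) 1 = fps_nth (fps_const fps_X) 1"
      by simp
    then show False
      by (simp add: fps_outer_def)
  qed
  have lin\<epsilon>: "coeff00 (\<epsilon> s) = fps_nth s 0" "coeff10 (\<epsilon> s) = fps_nth s 1 * p"
    "coeff01 (\<epsilon> s) = fps_nth s 1 * q" for s
    using \<epsilon> distinct by (auto simp: coeff_defs fps_outer_def p_def q_def)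
  have det: "coeff10 f * q - coeff01 f * p \<noteq> 0"
    using \<epsilon> distinct by (auto simp: p_def q_def)
  have "ring_morphism \<epsilon>"
    using \<epsilon> ring_morphism_fps_outer ring_morphism_fps_const by auto
  note e = ring_morphismD[OF this]
  have lin_add: "coeff00 (x + y) = coeff00 x + coeff00 y" "coeff10 (x + y) = coeff10 x + coeff10 y"
    "coeff01 (x + y) = coeff01 x + coeff01 y" for x y :: "real fps fps"
    by (simp_all add: coeff_defs)
  have lin_mult: "coeff00 (x * y) = coeff00 x * coeff00 y" "coeff10 (x * y) = coeff00 x * coeff10 y + coeff10 x * coeff00 y"
    "coeff01 (x * y) = coeff00 x * coeff01 y + coeff01 x * coeff00 y" for x y :: "real fps fps"
    by (simp_all add: coeff_defs fps_mult_nth)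
  have h0: "fps_nth h 0 = 0"
    using G(2) by (simp add: G(1) lin_add lin_mult f lin\<epsilon>)
  have 1: "coeff10 f * coeff00 k + fps_nth h 1 * p = 0" and 2: "coeff01 f * coeff00 k + fps_nth h 1 * q = 0"
    using G(3,4) by (simp_all add: G(1) lin_add lin_mult f lin\<epsilon>)
  \<comment> \<open>The linear part of \<open>G\<close> combines the independent gradients of
    \<open>f\<close> and of the parameter with coefficients \<open>coeff00 k\<close> and
    \<open>fps_nth h 1\<close>. As it vanishes, so do both coefficients.\<close>
  have "(coeff10 f * q - coeff01 f * p) * coeff00 k
      = q * (coeff10 f * coeff00 k + fps_nth h 1 * p) - p * (coeff01 f * coeff00 k + fps_nth h 1 * q)"
    by (simp add: algebra_simps)
  then have k0: "coeff00 k = 0"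
    using det 1 2 by simp
  then have h1: "fps_nth h 1 = 0"
    using 1 2 by (auto simp: p_def q_def)
  obtain n r \<sigma> where n: "n \<ge> 1" and \<sigma>: "\<sigma> = 1 \<or> \<sigma> = - 1" and r0: "fps_nth r 0 \<noteq> 0"
    and root: "fps_const \<sigma> * h = (fps_X * r) ^ (n + 1)"
    using fps_power_factorization[OF \<open>h \<noteq> 0\<close> h0 h1] by blast
  define s where "s = fps_const (fps_const \<sigma>)"
  have "\<epsilon> (fps_const c) = fps_const (fps_const c)" for c
    using \<epsilon> by (auto simp: fps_outer_def fps_eq_iff)
  with root have root': "s * \<epsilon> h = \<epsilon> (fps_X * r) ^ (n + 1)"
    by (metis e(4,5) s_def)
  \<comment> \<open>Being its own inverse, \<open>s\<close> can be moved to the other side as the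
    required unit.\<close>
  have "\<sigma> * \<sigma> = 1"
    using \<sigma> by auto
  then have ss: "s * s = 1"
    by (simp add: s_def)
  define T where "T = fps_X + fps_const k"
  define H where "H = const3 (1 / 2)"
  have HH: "H + H = 1"
    by (simp add: H_def const3_def)
  define y1 y2 y3 where "y1 = H * (T + fps_const (s * f))" and "y2 = H * (T - fps_const (s * f))"
    and "y3 = fps_const (\<epsilon> (fps_X * r))"
  have "y1 ^ 2 - y2 ^ 2 = (H + H) ^ 2 * (T * fps_const (s * f))"
    unfolding y1_def y2_def by (simp add: algebra_simps power2_eq_square)
  then have diff: "y1 ^ 2 - y2 ^ 2 = fps_const s * (T * fps_const f)"
    by (simp add: HH mult_ac flip: fps_const_mult)
  have "y3 ^ (n + 1) = fps_const s * fps_const (\<epsilon> h)"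
    by (simp only: y3_def fps_const_power root'[symmetric] fps_const_mult)
  with diff have "y1 ^ 2 - y2 ^ 2 + y3 ^ (n + 1) = fps_const s * (T * fps_const f + fps_const (\<epsilon> h))"
    by (simp add: algebra_simps)
  then have "fps_const s * (y1 ^ 2 - y2 ^ 2 + y3 ^ (n + 1)) = T * fps_const f + fps_const (\<epsilon> h)"
    by (simp add: ss flip: mult.assoc)
  also have "\<dots> = fps_const G + fps_X * fps_const f"
    by (simp add: G(1) T_def algebra_simps flip: fps_const_mult fps_const_add)
  finally have eq: "fps_const G + fps_X * fps_const f =
      fps_const s * (y1 ^ 2 - y2 ^ 2 + y3 ^ (n + 1))" ..
  have H_nth: "fps_nth (H * w) i = fps_const (fps_const (1 / 2)) * fps_nth w i" for w i
    by (simp add: H_def const3_def)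
  have H_0: "fps_nth H 0 = fps_const (fps_const (1 / 2))"
    by (simp add: H_def const3_def)
  have c: "coeff3 w 0 0 0 = coeff00 (fps_nth w 0)" "coeff3 w 1 0 0 = coeff00 (fps_nth w 1)"
    "coeff3 w 0 1 0 = coeff10 (fps_nth w 0)" "coeff3 w 0 0 1 = coeff01 (fps_nth w 0)" for w
    by (simp_all add: coeff3_def coeff_defs)
  have lin_const: "coeff00 (fps_const (fps_const c)) = c" "coeff10 (fps_const (fps_const c)) = 0"
    "coeff01 (fps_const (fps_const c)) = 0" "coeff00 1 = (1 :: real)" "coeff00 0 = (0 :: real)" for c :: real
    by (simp_all add: coeff_defs)
  have lin_diff: "coeff00 (x - y) = coeff00 x - coeff00 y" "coeff10 (x - y) = coeff10 x - coeff10 y"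
    "coeff01 (x - y) = coeff01 x - coeff01 y" for x y :: "real fps fps"
    by (simp_all add: coeff_defs)
  note lins = c H_nth H_0 lin_const lin_add lin_mult lin_diff f k0 lin\<epsilon> s_def
  have y1: "coeff3 y1 0 0 0 = 0" "coeff3 y1 1 0 0 = 1 / 2"
    "coeff3 y1 0 1 0 = (coeff10 k + \<sigma> * coeff10 f) / 2" "coeff3 y1 0 0 1 = (coeff01 k + \<sigma> * coeff01 f) / 2"
    by (simp_all add: y1_def T_def lins del: One_nat_def)
  have y2: "coeff3 y2 0 0 0 = 0" "coeff3 y2 1 0 0 = 1 / 2"
    "coeff3 y2 0 1 0 = (coeff10 k - \<sigma> * coeff10 f) / 2" "coeff3 y2 0 0 1 = (coeff01 k - \<sigma> * coeff01 f) / 2"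
    by (simp_all add: y2_def T_def lins del: One_nat_def)
  have y3: "coeff3 y3 0 0 0 = 0" "coeff3 y3 1 0 0 = 0"
    "coeff3 y3 0 1 0 = fps_nth r 0 * p" "coeff3 y3 0 0 1 = fps_nth r 0 * q"
    by (simp_all add: y3_def lins del: One_nat_def)
  have "local_coordinates y1 y2 y3"
  proof -
    have "det (vector [vector [coeff3 y1 1 0 0, coeff3 y1 0 1 0, coeff3 y1 0 0 1],
                  vector [coeff3 y2 1 0 0, coeff3 y2 0 1 0, coeff3 y2 0 0 1],
                  vector [coeff3 y3 1 0 0, coeff3 y3 0 1 0, coeff3 y3 0 0 1]]
          :: real ^ 3 ^ 3) = - (\<sigma> * fps_nth r 0 * (coeff10 f * q - coeff01 f * p)) / 2"
      unfolding det_3 vector_3 y1 y2 y3 by (simp add: field_simps)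
    then show ?thesis
      using \<sigma> r0 det y1(1) y2(1) y3(1) unfolding local_coordinates_def by auto
  qed
  moreover have "fps_const s dvd 1"
    using ss by (metis dvdI fps_const_mult fps_const_1_eq_1)
  ultimately show ?thesis
    using eq n by blast
qed

section \<open>Singularities of monoid surfaces\<close>

abbreviation const2 :: "real \<Rightarrow> real fps fps" where
  "const2 c \<equiv> fps_const (fps_const c)"

lemma ring_morphism_const2: "ring_morphism const2"
  by (rule ring_morphism_compose[OF ring_morphism_fps_const ring_morphism_fps_const])

text \<open>Scale the point by \<open>1 + fps_X\<close> and compare the coefficients of
  \<open>fps_X\<close> in the homogeneity relation, using the chain rule on one side.\<close>

lemma euler_identity:
  fixes f :: "'a :: idom poly3"
  assumes "homogeneous3 m f"
  shows "eval3 (\<lambda>c. c) (pderiv f) a b c * a + eval3 (\<lambda>c. c) (map_poly pderiv f) a b c * b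
    + eval3 (\<lambda>c. c) (map_poly (map_poly pderiv) f) a b c * c
    = of_nat m * eval3 (\<lambda>c. c) f a b c"
proof -
  let ?\<epsilon> = "\<lambda>s :: 'a fps. fps_nth s 0" and ?D = "\<lambda>s :: 'a fps. fps_nth s 1"
  have \<epsilon>: "ring_morphism ?\<epsilon>" and D: "point_derivation ?\<epsilon> ?D"
    by (simp_all add: ring_morphism_def point_derivation_def fps_mult_nth)
  let ?l = "1 + fps_X :: 'a fps"
  have "?D (?l ^ m) = of_nat m \<and> ?\<epsilon> (?l ^ m) = 1"
    by (induction m) (auto simp: fps_mult_nth)
  moreover have "eval3 fps_const f (?l * fps_const a) (?l * fps_const b) (?l * fps_const c)
      = ?l ^ m * fps_const (eval3 (\<lambda>c. c) f a b c)"
    using eval3_homogeneous[OF assms, of fps_const]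
      morphism_eval3[OF ring_morphism_fps_const, of "\<lambda>c. c" f] by simp
  ultimately show ?thesis
    using derivation_eval3[OF \<epsilon> D ring_morphism_fps_const,
        where x = "?l * fps_const a" and y = "?l * fps_const b" and z = "?l * fps_const c" and f = f]
    by (simp add: fps_mult_nth)
qed

text \<open>The three alternatives for \<open>c1, c2, c3\<close> are the charts \<open>x\<^sub>i = 1\<close> with \<open>i \<noteq> 0\<close>.\<close>

lemma monoid_local_equation_A_minus:
  fixes f g :: "real poly3" and a1 a2 a3 p0 l :: real
  defines "ev \<equiv> \<lambda>q. eval3 (\<lambda>c. c) q a1 a2 a3"
  assumes f: "homogeneous3 m f" and g: "homogeneous3 n g" and gcd: "gcd f g = 1"
    and f0: "ev f = 0" and g0: "ev g = 0"
    and smooth: "ev (pderiv f) \<noteq> 0 \<or> ev (map_poly pderiv f) \<noteq> 0 \<or>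
      ev (map_poly (map_poly pderiv) f) \<noteq> 0"
    and sing: "p0 * ev (pderiv f) + ev (pderiv g) = 0"
      "p0 * ev (map_poly pderiv f) + ev (map_poly pderiv g) = 0"
      "p0 * ev (map_poly (map_poly pderiv) f) + ev (map_poly (map_poly pderiv) g) = 0"
    and mn: "n = Suc m" and l: "l \<noteq> 0"
    and chart: "c1 = 1 \<and> c2 = const2 (a2 / l) + fps_X \<and> c3 = const2 (a3 / l) + fps_const fps_X \<and> a1 = l
      \<or> c1 = const2 (a1 / l) + fps_X \<and> c2 = 1 \<and> c3 = const2 (a3 / l) + fps_const fps_X \<and> a2 = l
      \<or> c1 = const2 (a1 / l) + fps_X \<and> c2 = const2 (a2 / l) + fps_const fps_X \<and> c3 = 1 \<and> a3 = l"
  defines "F \<equiv> eval3 const2 f c1 c2 c3"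
  defines "G \<equiv> const2 (p0 / l) * F + eval3 const2 g c1 c2 c3"
  shows "\<exists>n\<ge>1. \<exists>y1 y2 y3 u. local_coordinates y1 y2 y3 \<and> u dvd 1 \<and>
    fps_const G + fps_X * fps_const F = u * (y1 ^ 2 - y2 ^ 2 + y3 ^ (n + 1))"
proof -
  have lin_add: "coeff00 (x + y) = coeff00 x + coeff00 y" "coeff10 (x + y) = coeff10 x + coeff10 y"
    "coeff01 (x + y) = coeff01 x + coeff01 y" for x y :: "real fps fps"
    by (simp_all add: coeff_defs)
  have lin_smult: "coeff00 (const2 c * y) = c * coeff00 y" "coeff10 (const2 c * y) = c * coeff10 y"
    "coeff01 (const2 c * y) = c * coeff01 y" for c and y :: "real fps fps"
    by (simp_all add: coeff_defs)
  have lin_const: "coeff00 (const2 c) = c" "coeff10 (const2 c) = 0" "coeff01 (const2 c) = 0"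
    "coeff00 1 = (1 :: real)" "coeff10 1 = (0 :: real)" "coeff01 1 = (0 :: real)" for c
    by (simp_all add: coeff_defs)
  have lin_var: "coeff00 fps_X = (0 :: real)" "coeff10 fps_X = (1 :: real)" "coeff01 fps_X = (0 :: real)"
    "coeff00 (fps_const w) = fps_nth w 0" "coeff10 (fps_const w) = 0" "coeff01 (fps_const w) = fps_nth w 1"
    for w :: "real fps"
    by (simp_all add: coeff_defs)
  note lins = lin_add lin_smult lin_const lin_var
  have c: "coeff00 (const2 l * c1) = a1" "coeff00 (const2 l * c2) = a2" "coeff00 (const2 l * c3) = a3"
    using chart l by (auto simp: lins)
  \<comment> \<open>Multiplying the affine coordinates by \<open>l\<close> returns to the
    representative \<open>(a1, a2, a3)\<close>, at which the derivatives in \<open>ev\<close> are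
    taken.\<close>
  have scale: "const2 (l ^ k) * eval3 const2 q c1 c2 c3
      = eval3 const2 q (const2 l * c1) (const2 l * c2) (const2 l * c3)"
    if "homogeneous3 k q" for k q
    using eval3_homogeneous[OF that, of const2] by (simp add: fps_const_power)
  have value0: "l ^ k * coeff00 (eval3 const2 q c1 c2 c3) = ev q" if "homogeneous3 k q" for k q
  proof -
    have "coeff00 (eval3 const2 q (const2 l * c1) (const2 l * c2) (const2 l * c3)) = ev q"
      unfolding ev_def by (subst morphism_eval3[OF ring_morphism_coeff00]) (simp_all add: c lin_const)
    then show ?thesis
      by (simp add: lins flip: scale[OF that])
  qed
  have value1: "l ^ k * coeff10 (eval3 const2 q c1 c2 c3)
      = l * (ev (pderiv q) * coeff10 c1 + ev (map_poly pderiv q) * coeff10 c2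
        + ev (map_poly (map_poly pderiv) q) * coeff10 c3)" if "homogeneous3 k q" for k q
    using derivation_eval3[OF ring_morphism_coeff00 point_derivation_coeff10 ring_morphism_const2 lin_const(2),
        where f = q and x = "const2 l * c1" and y = "const2 l * c2" and z = "const2 l * c3"]
    unfolding c ev_def scale[OF that, symmetric] by (simp only: lins) (simp add: algebra_simps)
  have value2: "l ^ k * coeff01 (eval3 const2 q c1 c2 c3)
      = l * (ev (pderiv q) * coeff01 c1 + ev (map_poly pderiv q) * coeff01 c2
        + ev (map_poly (map_poly pderiv) q) * coeff01 c3)" if "homogeneous3 k q" for k q
    using derivation_eval3[OF ring_morphism_coeff00 point_derivation_coeff01 ring_morphism_const2 lin_const(3),
        where f = q and x = "const2 l * c1" and y = "const2 l * c2" and z = "const2 l * c3"]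
    unfolding c ev_def scale[OF that, symmetric] by (simp only: lins) (simp add: algebra_simps)
  have F0: "coeff00 F = 0"
    using value0[OF f] f0 l by (simp add: F_def)
  have G0: "coeff00 G = 0"
    using value0[OF g] g0 l F0 by (simp add: G_def lins)
  \<comment> \<open>As \<open>n = Suc m\<close>, the additional factor \<open>l\<close> cancels the
    denominator of \<open>p0 / l\<close>. What remains is a combination of the left-hand sides in
    \<open>sing\<close>.\<close>
  have "l ^ n * coeff10 G = l * (coeff10 c1 * (p0 * ev (pderiv f) + ev (pderiv g))
      + coeff10 c2 * (p0 * ev (map_poly pderiv f) + ev (map_poly pderiv g))
      + coeff10 c3 * (p0 * ev (map_poly (map_poly pderiv) f) + ev (map_poly (map_poly pderiv) g)))"
  proof -
    have "coeff10 G = p0 / l * coeff10 F + coeff10 (eval3 const2 g c1 c2 c3)"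
      by (simp only: G_def lins)
    then have "l ^ n * coeff10 G = p0 * (l ^ m * coeff10 F) + l ^ n * coeff10 (eval3 const2 g c1 c2 c3)"
      using l by (simp add: mn distrib_left)
    then show ?thesis
      unfolding F_def value1[OF f] value1[OF g] by (simp add: algebra_simps)
  qed
  then have G1: "coeff10 G = 0"
    using l by (simp add: sing)
  have "l ^ n * coeff01 G = l * (coeff01 c1 * (p0 * ev (pderiv f) + ev (pderiv g))
      + coeff01 c2 * (p0 * ev (map_poly pderiv f) + ev (map_poly pderiv g))
      + coeff01 c3 * (p0 * ev (map_poly (map_poly pderiv) f) + ev (map_poly (map_poly pderiv) g)))"
  proof -
    have "coeff01 G = p0 / l * coeff01 F + coeff01 (eval3 const2 g c1 c2 c3)"
      by (simp only: G_def lins)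
    then have "l ^ n * coeff01 G = p0 * (l ^ m * coeff01 F) + l ^ n * coeff01 (eval3 const2 g c1 c2 c3)"
      using l by (simp add: mn distrib_left)
    then show ?thesis
      unfolding F_def value2[OF f] value2[OF g] by (simp add: algebra_simps)
  qed
  then have G2: "coeff01 G = 0"
    using l by (simp add: sing)
  \<comment> \<open>By Euler's identity and \<open>l \<noteq> 0\<close>, the partial derivative in
    the variable set to one is determined by the other two. Hence smoothness is visible in the
    chart.\<close>
  have "ev (pderiv f) * a1 + ev (map_poly pderiv f) * a2 + ev (map_poly (map_poly pderiv) f) * a3 = 0"
    using euler_identity[OF f, of a1 a2 a3] f0 by (simp add: ev_def)
  then have F12: "coeff10 F \<noteq> 0 \<or> coeff01 F \<noteq> 0"
    using chart smooth l value1[OF f] value2[OF f] unfolding F_def[symmetric]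
    by (auto simp: lins)
  obtain \<epsilon> \<rho> where \<epsilon>: "\<epsilon> = fps_outer \<and> coeff01 F \<noteq> 0 \<or> \<epsilon> = fps_const \<and> coeff10 F \<noteq> 0"
    and \<rho>: "ring_morphism \<rho>" "\<rho> F = 0" "\<And>h. \<rho> (\<epsilon> h) = h" "\<And>x. F dvd x - \<epsilon> (\<rho> x)"
    using smooth_curve_restriction[OF F0 F12] by metis
  note r = ring_morphismD[OF \<rho>(1)]
  have \<epsilon>_const: "\<epsilon> (fps_const c) = const2 c" for c
    using \<epsilon> by (auto simp: fps_outer_def fps_eq_iff)
  then have \<rho>_const: "\<rho> (const2 c) = fps_const c" for c
    by (metis \<rho>(3))
  \<comment> \<open>The parameter embedded by \<epsilon> restricts to \<open>fps_X\<close>, so the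
    arc is not constant.\<close>
  have "\<epsilon> fps_X = fps_X \<or> \<epsilon> fps_X = fps_const fps_X"
    using \<epsilon> by (auto simp: fps_outer_def fps_eq_iff)
  then have \<rho>_X: "\<rho> fps_X = fps_X \<or> \<rho> (fps_const fps_X) = fps_X"
    by (metis \<rho>(3))
  have "\<rho> G \<noteq> 0"
  proof
    assume "\<rho> G = 0"
    then have zero: "eval3 fps_const f (\<rho> c1) (\<rho> c2) (\<rho> c3) = 0" "eval3 fps_const g (\<rho> c1) (\<rho> c2) (\<rho> c3) = 0"
      using \<rho>(2) morphism_eval3[OF \<rho>(1), of const2 f c1 c2 c3]
        morphism_eval3[OF \<rho>(1), of const2 g c1 c2 c3]
      unfolding G_def F_def by (simp_all add: r \<rho>_const)
    \<comment> \<open>Since the forms are homogeneous, they still vanish after scaling the arc by a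
      polynomial variable.\<close>
    have generic: "eval3 fps_poly_const q (monom (\<rho> c1) 1) (monom (\<rho> c2) 1) (monom (\<rho> c3) 1) = 0"
      if "homogeneous3 k q" "eval3 fps_const q (\<rho> c1) (\<rho> c2) (\<rho> c3) = 0" for k q
    proof -
      have mon: "monom w 1 = monom 1 1 * [:w:]" for w :: "real fps"
        by (simp add: monom_altdef)
      show ?thesis
        unfolding mon[of "\<rho> c1"] mon[of "\<rho> c2"] mon[of "\<rho> c3"]
        using morphism_eval3[OF ring_morphism_const_poly, of fps_const q "\<rho> c1" "\<rho> c2" "\<rho> c3"] that(2)
        by (subst eval3_homogeneous[OF that(1)]) simp_all
    qed
    obtain s \<alpha> \<beta> \<gamma> where s: "\<rho> c1 = fps_const \<alpha> * s" "\<rho> c2 = fps_const \<beta> * s" "\<rho> c3 = fps_const \<gamma> * s"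
      using coprime_ternary_common_zero_constant[OF gcd generic[OF f zero(1)] generic[OF g zero(2)]]
      by blast
    have s_const: "\<exists>c. s = fps_const c" if "1 = fps_const a * s" for a
    proof -
      have "a \<noteq> 0"
        using that by auto
      then have "s = fps_const (1 / a) * (fps_const a * s)"
        by (simp flip: mult.assoc)
      then show ?thesis
        using that by (metis mult.right_neutral)
    qed
    \<comment> \<open>One affine coordinate equals one, which forces the common factor
      \<open>s\<close>, and with it the whole arc, to be constant.\<close>
    have "\<exists>c. s = fps_const c"
      using chart s s_const by (auto simp: r)
    then obtain c where "s = fps_const c" ..
    with s have const: "\<exists>a. \<rho> c1 = fps_const a" "\<exists>a. \<rho> c2 = fps_const a" "\<exists>a. \<rho> c3 = fps_const a"
      by auto
    have X: "fps_const a + fps_X \<noteq> fps_const b" for a b :: real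
      using arg_cong[of "fps_const a + fps_X" "fps_const b" "\<lambda>s. fps_nth s 1"] by auto
    show False
      using chart \<rho>_X const X by (auto simp: r \<rho>_const simp del: fps_const_add)
  qed
  moreover obtain k where "G - \<epsilon> (\<rho> G) = F * k"
    using \<rho>(4)[of G] by blast
  then have "G = F * k + \<epsilon> (\<rho> G)"
    by (simp add: algebra_simps)
  ultimately show ?thesis
    using A_minus_normal_form[OF F0 _ G0 G1 G2 _ \<epsilon>] by blast
qed

lemma eval4_linear:
  "h 0 = 0 \<Longrightarrow> eval4 h [:g, f:] w x y z = eval3 h g x y z + w * eval3 h f x y z"
  by (simp add: eval4_def poly_map_poly_pCons eval3_def)

theorem proposition8:
  fixes d :: nat and f g :: "real poly3" and P :: "real ^ 4"
  assumes "d \<ge> 3"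
    and "nondegenerate_monoid d f g"
    and "surface_singular_at (monoid_poly f g) P"
    and "\<not> same_point P (axis 0 1)"
  shows "\<exists>n\<ge>1. A_minus_singularity n (monoid_poly f g) P"
proof -
  let ?ev = "\<lambda>q. eval3 (\<lambda>c. c) q (P $ 1) (P $ 2) (P $ 3)"
  have F: "monoid_poly f g = [:g, f:]"
    by (simp add: monoid_poly_def monom_altdef)
  have f: "homogeneous3 (d - 1) f" and g: "homogeneous3 d g" and gcd: "gcd f g = 1"
    and nonsing: "\<And>z. \<not> (curve_singular_at f z \<and> curve_singular_at g z)"
    using assms(2) by (auto simp: nondegenerate_monoid_def)
  have "P \<noteq> 0" and f0: "?ev f = 0" and g0: "?ev g = 0"
    and sing: "P $ 0 * ?ev (pderiv f) + ?ev (pderiv g) = 0"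
      "P $ 0 * ?ev (map_poly pderiv f) + ?ev (map_poly pderiv g) = 0"
      "P $ 0 * ?ev (map_poly (map_poly pderiv) f) + ?ev (map_poly (map_poly pderiv) g) = 0"
    using assms(3) unfolding surface_singular_at_def F
    by (auto simp: map_poly_pCons pderiv_pCons eval4_linear id_def add.commute
        eval4_linear[where f = 0, simplified] eval3_def)
  \<comment> \<open>\<open>forall_4\<close> enumerates the indices as 1, 2, 3, 4, and 4 is the
    element 0 of the index type.\<close>
  have P4: "P $ 4 = P $ 0"
    by (rule arg_cong[where f = "($) P"]) simp
  have "P $ 1 \<noteq> 0 \<or> P $ 2 \<noteq> 0 \<or> P $ 3 \<noteq> 0"
  proof (rule ccontr)
    assume "\<not> ?thesis"
    then have "P = P $ 0 *s axis 0 1"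
      by (simp add: P4 vec_eq_iff forall_4 axis_def)
    with \<open>P \<noteq> 0\<close> assms(4) show False
      unfolding same_point_def by (metis vector_smult_lzero)
  qed
  then obtain i where i: "i \<in> {1, 2, 3}" "P $ i \<noteq> 0"
    by auto
  \<comment> \<open>If the gradient of \<open>f\<close> vanished, the equations \<open>sing\<close>
    would make that of \<open>g\<close> vanish, too. The real point, viewed as a complex one, would
    then be a common singular point.\<close>
  have smooth: "?ev (pderiv f) \<noteq> 0 \<or> ?ev (map_poly pderiv f) \<noteq> 0 \<or>
      ?ev (map_poly (map_poly pderiv) f) \<noteq> 0"
  proof (rule ccontr)
    assume "\<not> ?thesis"
    moreover define z :: "complex ^ 3" where
      "z = vector [complex_of_real (P $ 1), complex_of_real (P $ 2), complex_of_real (P $ 3)]"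
    have "eval3 complex_of_real q (z $ 1) (z $ 2) (z $ 3) = complex_of_real (?ev q)" for q
      using morphism_eval3[OF ring_morphism_of_real, of "\<lambda>c. c" q] by (simp add: z_def)
    moreover have "z \<noteq> 0"
      using i by (auto simp: z_def vec_eq_iff forall_3)
    ultimately have "curve_singular_at f z \<and> curve_singular_at g z"
      using f0 g0 sing by (auto simp: curve_singular_at_def)
    with nonsing show False
      by blast
  qed
  have "d = Suc (d - 1)"
    using assms(1) by simp
  note core = monoid_local_equation_A_minus[OF f g gcd f0 g0 smooth sing this i(2)]
  have const3: "fps_const (const2 c) = const3 c" for c
    by (simp add: const3_def)
  have lift: "eval3 const3 q (fps_const c1) (fps_const c2) (fps_const c3)
      = fps_const (eval3 const2 q c1 c2 c3)" for q c1 c2 c3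
    using morphism_eval3[OF ring_morphism_fps_const, of const2] by (simp add: const3)
  \<comment> \<open>The parameter \<open>t1\<close> is centered at \<open>b\<close>, so the part
    free of \<open>t1\<close> contains \<open>b\<close> times \<open>f\<close> besides
    \<open>g\<close>.\<close>
  have eq: "eval4 const3 (monoid_poly f g) (const3 b + t1) (fps_const c1) (fps_const c2) (fps_const c3)
      = fps_const (const2 b * eval3 const2 f c1 c2 c3 + eval3 const2 g c1 c2 c3)
        + fps_X * fps_const (eval3 const2 f c1 c2 c3)" for b c1 c2 c3
    by (simp add: F eval4_linear lift t1_def const3_def algebra_simps flip: fps_const_mult fps_const_add)
  have coord: "const3 b + t2 = fps_const (const2 b + fps_X)"
    "const3 b + t3 = fps_const (const2 b + fps_const fps_X)" for b
    by (simp_all add: const3_def t2_def t3_def)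
  have "\<exists>n\<ge>1. \<exists>y1 y2 y3 u. local_coordinates y1 y2 y3 \<and> u dvd 1 \<and>
    local_equation i (monoid_poly f g) P = u * (y1 ^ 2 - y2 ^ 2 + y3 ^ (n + 1))"
  proof -
    let ?b = "\<lambda>j. const2 (P $ j / P $ i)"
    consider "i = 1" | "i = 2" | "i = 3"
      using i(1) by auto
    then obtain c1 c2 c3 where chart:
      "c1 = 1 \<and> c2 = ?b 2 + fps_X \<and> c3 = ?b 3 + fps_const fps_X \<and> P $ 1 = P $ i
        \<or> c1 = ?b 1 + fps_X \<and> c2 = 1 \<and> c3 = ?b 3 + fps_const fps_X \<and> P $ 2 = P $ i
        \<or> c1 = ?b 1 + fps_X \<and> c2 = ?b 2 + fps_const fps_X \<and> c3 = 1 \<and> P $ 3 = P $ i"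
      and equation: "local_equation i (monoid_poly f g) P = eval4 const3 (monoid_poly f g)
          (const3 (P $ 0 / P $ i) + t1) (fps_const c1) (fps_const c2) (fps_const c3)"
    proof cases
      case 1
      show ?thesis
        by (rule that[of 1 "?b 2 + fps_X" "?b 3 + fps_const fps_X"])
          (simp only: 1 simp_thms, simp add: 1 local_equation_def Let_def coord)
    next
      case 2
      show ?thesis
        by (rule that[of "?b 1 + fps_X" 1 "?b 3 + fps_const fps_X"])
          (simp only: 2 simp_thms, simp add: 2 local_equation_def Let_def coord)
    next
      case 3
      show ?thesis
        by (rule that[of "?b 1 + fps_X" "?b 2 + fps_const fps_X" 1])
          (simp only: 3 simp_thms, simp add: 3 local_equation_def Let_def coord)
    qed
    show ?thesis
      unfolding equation eq by (rule core[OF chart])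
  qed
  with i(2) assms(3) show ?thesis
    unfolding A_minus_singularity_def by blast
qed

end
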